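(* Let $A$ and $B$ be arbitrary non-empty sets (finite or infinite), and let $\mathcal T$ be a set of $A$-to-$B$ constraints. The following are equivalent: (i) $\mathcal T$ is locally closed, contains the binary equality constraint $(=_A,=_B)$, contains the empty constraint, and is closed under formation of conjunctive minors; (ii) $\mathcal T$ is characterized by some set of $B$-valued functions on $A$.
   Context: Positive integers are identified with $n=\{0,\dots,n-1\}$; tuples are maps. A $B$-valued function on $A$ is a map $f:A^n\to B$, $n\ge1$. An $m$-ary $A$-to-$B$ constraint is a pair $(R,S)$ with $R\subseteq A^m$, $S\subseteq B^m$ ($m$ a positive integer); $R$ is the antecedent and $S$ the consequent. For an $m\times n$ matrix $M=(\mathbf a^1\ldots\mathbf a^n)$ with columns $\mathbf a^k\in A^m$, $M\prec R$ means all columns are in $R$, and $fM=(f(\mathbf a^1(i),\dots,\mathbf a^n(i))\mid i\in m)$; $f$ satisfies $(R,S)$ if $fM\in S$ for every $m\times n$ matrix $M\prec R$. $=_A$ denotes the binary equality relation on $A$. The empty constraint is a constraint $(\emptyset,\emptyset)$ with empty antecedent and consequent. A relaxation of $(R,S)$ is a constraint $(R',S')$ of the same arity with $R'\subseteq R$ and $S'\supseteq S$. $\mathcal T$ is locally closed if for every $A$-to-$B$ constraint $(R,S)$: if every relaxation of $(R,S)$ with finite antecedent belongs to $\mathcal T$, then $(R,S)\in\mathcal T$. $\mathcal T$ is characterized by a set $\mathcal F$ of functions if $\mathcal T$ is exactly the set of constraints satisfied by every member of $\mathcal F$. Conjunctive minors: let $m$ be a positive integer, $V$ an arbitrary set disjoint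 from the natural numbers, and $H=(h_j)_{j\in J}$ a non-empty family of maps $h_j:n_j\to m\cup V$ ($n_j$ positive integers). For $\mathbf a\in C^m$ and $\sigma:V\to C$, $\mathbf a+\sigma:m\cup V\to C$ agrees with $\mathbf a$ on $m$ and $\sigma$ on $V$, and $(\mathbf a+\sigma)h_j\in C^{n_j}$ is the composite. $R\subseteq C^m$ is a restrictive conjunctive minor of $(R_j)_{j\in J}$ ($R_j\subseteq C^{n_j}$) via $H$ if each $\mathbf a\in R$ admits $\sigma:V\to C$ with $(\mathbf a+\sigma)h_j\in R_j$ for all $j$; it is an extensive conjunctive minor if every $\mathbf a\in C^m$ admitting such a $\sigma$ lies in $R$. $(R,S)$ is a conjunctive minor of $(R_j,S_j)_{j\in J}$ via $H$ if $R$ is a restrictive conjunctive minor of $(R_j)$ (with $C=A$) and $S$ is an extensive conjunctive minor of $(S_j)$ (with $C=B$) via $H$. $\mathcal T$ is closed under formation of conjunctive minors if for every non-empty family of members of $\mathcal T$, every conjunctive minor of it (via any such scheme with finite $m,n_j$, arbitrary $J$ and $V$) is in $\mathcal T$. *)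

theory Defs
  imports Main "HOL-Library.NList" "HOL-Library.FuncSet"
begin

text \<open>
  The set of tuples \<open>C^n\<close> is the set \<open>nlists n C\<close> of lists of length \<open>n\<close> over \<open>C\<close>; position \<open>i\<close> of
  a list is the value of the tuple at \<open>i \<in> {0, \<dots>, n - 1}\<close>.  A constraint is just a pair of sets of
  tuples, without an arity tag, so that the pair of empty sets is a constraint of every arity.
\<close>

type_synonym ('a, 'b) constraint = "'a list set \<times> 'b list set"

definition constraints :: "nat \<Rightarrow> 'a set \<Rightarrow> 'b set \<Rightarrow> ('a, 'b) constraint set" where
  "constraints m A B = {(R, S). R \<subseteq> nlists m A \<and> S \<subseteq> nlists m B}"

definition all_constraints :: "'a set \<Rightarrow> 'b set \<Rightarrow> ('a, 'b) constraint set" where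
  "all_constraints A B = (\<Union>m\<in>{1..}. constraints m A B)"

definition valued_functions :: "'a set \<Rightarrow> 'b set \<Rightarrow> (nat \<times> ('a list \<Rightarrow> 'b)) set" where
  "valued_functions A B = {(n, f). n \<ge> 1 \<and> f \<in> nlists n A \<rightarrow>\<^sub>E B}"

text \<open>A matrix with \<open>m\<close> rows is the list \<open>M\<close> of its columns.\<close>

definition apply_matrix :: "nat \<Rightarrow> ('a list \<Rightarrow> 'b) \<Rightarrow> 'a list list \<Rightarrow> 'b list" where
  "apply_matrix m f M = map (\<lambda>i. f (map (\<lambda>a. a ! i) M)) [0..<m]"

definition satisfies :: "nat \<Rightarrow> nat \<times> ('a list \<Rightarrow> 'b) \<Rightarrow> ('a, 'b) constraint \<Rightarrow> bool" where
  "satisfies m = (\<lambda>(n, f) (R, S). \<forall>M \<in> nlists n R. apply_matrix m f M \<in> S)"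

definition characterized_by ::
    "'a set \<Rightarrow> 'b set \<Rightarrow> ('a, 'b) constraint set \<Rightarrow> (nat \<times> ('a list \<Rightarrow> 'b)) set \<Rightarrow> bool" where
  "characterized_by A B T F \<longleftrightarrow>
     T = (\<Union>m\<in>{1..}. {c \<in> constraints m A B. \<forall>\<phi>\<in>F. satisfies m \<phi> c})"

definition eq_rel :: "'c set \<Rightarrow> 'c list set" where
  "eq_rel C = {[x, x] | x. x \<in> C}"

definition relaxation ::
    "nat \<Rightarrow> 'a set \<Rightarrow> 'b set \<Rightarrow> ('a, 'b) constraint \<Rightarrow> ('a, 'b) constraint \<Rightarrow> bool" where
  "relaxation m A B c' c \<longleftrightarrow>
     c' \<in> constraints m A B \<and> c \<in> constraints m A B \<and> fst c' \<subseteq> fst c \<and> snd c \<subseteq> snd c'"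

definition locally_closed :: "'a set \<Rightarrow> 'b set \<Rightarrow> ('a, 'b) constraint set \<Rightarrow> bool" where
  "locally_closed A B T \<longleftrightarrow>
     (\<forall>m\<ge>1. \<forall>c \<in> constraints m A B.
        (\<forall>c'. relaxation m A B c' c \<and> finite (fst c') \<longrightarrow> c' \<in> T) \<longrightarrow> c \<in> T)"

text \<open>
  The set \<open>m \<union> V\<close> with \<open>V\<close> disjoint from the naturals is rendered as the disjoint sum
  \<open>{..<m} <+> V\<close>.  A map \<open>h\<^sub>j : n\<^sub>j \<rightarrow> m \<union> V\<close> is a tuple, hence a list of length \<open>n\<^sub>j\<close>, and
  \<open>comp_tuple a \<sigma> h\<close> is the composite \<open>(a + \<sigma>) h\<close>.
\<close>

definition minor_scheme ::
    "nat \<Rightarrow> 'v set \<Rightarrow> 'j set \<Rightarrow> ('j \<Rightarrow> nat) \<Rightarrow> ('j \<Rightarrow> (nat + 'v) list) \<Rightarrow> bool" where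
  "minor_scheme m V J n h \<longleftrightarrow>
     m \<ge> 1 \<and> J \<noteq> {} \<and> (\<forall>j\<in>J. n j \<ge> 1 \<and> h j \<in> nlists (n j) ({..<m} <+> V))"

definition comp_tuple :: "'c list \<Rightarrow> ('v \<Rightarrow> 'c) \<Rightarrow> (nat + 'v) list \<Rightarrow> 'c list" where
  "comp_tuple a \<sigma> h = map (case_sum (\<lambda>i. a ! i) \<sigma>) h"

definition restrictive_conj_minor ::
    "'c set \<Rightarrow> 'v set \<Rightarrow> 'j set \<Rightarrow> ('j \<Rightarrow> (nat + 'v) list) \<Rightarrow> ('j \<Rightarrow> 'c list set)
     \<Rightarrow> 'c list set \<Rightarrow> bool" where
  "restrictive_conj_minor C V J h Rs R \<longleftrightarrow>
     (\<forall>a\<in>R. \<exists>\<sigma> \<in> V \<rightarrow> C. \<forall>j\<in>J. comp_tuple a \<sigma> (h j) \<in> Rs j)"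

definition extensive_conj_minor ::
    "nat \<Rightarrow> 'c set \<Rightarrow> 'v set \<Rightarrow> 'j set \<Rightarrow> ('j \<Rightarrow> (nat + 'v) list) \<Rightarrow> ('j \<Rightarrow> 'c list set)
     \<Rightarrow> 'c list set \<Rightarrow> bool" where
  "extensive_conj_minor m C V J h Rs R \<longleftrightarrow>
     (\<forall>a \<in> nlists m C. (\<exists>\<sigma> \<in> V \<rightarrow> C. \<forall>j\<in>J. comp_tuple a \<sigma> (h j) \<in> Rs j) \<longrightarrow> a \<in> R)"

definition conj_minor ::
    "'a set \<Rightarrow> 'b set \<Rightarrow> nat \<Rightarrow> 'v set \<Rightarrow> 'j set \<Rightarrow> ('j \<Rightarrow> nat) \<Rightarrow> ('j \<Rightarrow> (nat + 'v) list)
     \<Rightarrow> ('j \<Rightarrow> ('a, 'b) constraint) \<Rightarrow> ('a, 'b) constraint \<Rightarrow> bool" where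
  "conj_minor A B m V J n h cs c \<longleftrightarrow>
     minor_scheme m V J n h \<and>
     c \<in> constraints m A B \<and> (\<forall>j\<in>J. cs j \<in> constraints (n j) A B) \<and>
     restrictive_conj_minor A V J h (\<lambda>j. fst (cs j)) (fst c) \<and>
     extensive_conj_minor m B V J h (\<lambda>j. snd (cs j)) (snd c)"

definition conj_minor_closed_over ::
    "'j itself \<Rightarrow> 'v itself \<Rightarrow> 'a set \<Rightarrow> 'b set \<Rightarrow> ('a, 'b) constraint set \<Rightarrow> bool" where
  "conj_minor_closed_over _ _ A B T \<longleftrightarrow>
     (\<forall>m (V :: 'v set) (J :: 'j set) n h cs c.
        (\<forall>j\<in>J. cs j \<in> T) \<and> conj_minor A B m V J n h cs c \<longrightarrow> c \<in> T)"

text \<open>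
  The index set \<open>J\<close> and the variable set \<open>V\<close> of a minor are arbitrary sets, but a formula cannot
  quantify over types.  It is enough to let them range over the subsets of two fixed types:
  a family may be indexed by its members, and variables of \<open>V\<close> on which the witnesses \<open>\<sigma>\<close> of all
  tuples of the antecedent agree may be identified.  The theorem
  \<open>conj_minor_closed_all_types\<close> below states that closure over these two types is closure over all
  types of indices and variables.
\<close>

type_synonym 'a minor_var = "'a list \<Rightarrow> 'a"

type_synonym ('a, 'b) minor_index = "(nat + 'a minor_var) list \<times> ('a, 'b) constraint"

definition conj_minor_closed :: "'a set \<Rightarrow> 'b set \<Rightarrow> ('a, 'b) constraint set \<Rightarrow> bool" where
  "conj_minor_closed A B T \<longleftrightarrow>
     conj_minor_closed_over TYPE(('a, 'b) minor_index) TYPE('a minor_var) A B T"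

theorem conj_minor_closed_all_types:
  fixes A :: "'a set" and B :: "'b set"
  assumes closed: "conj_minor_closed A B T"
  shows "conj_minor_closed_over TYPE('j) TYPE('v) A B T"
  unfolding conj_minor_closed_over_def
proof (intro allI impI, elim conjE)
  fix m and V :: "'v set" and J :: "'j set" and n h cs c
  assume mem: "\<forall>j\<in>J. cs j \<in> T" and minor: "conj_minor A B m V J n h cs c"
  have sch: "minor_scheme m V J n h" and c: "c \<in> constraints m A B"
    and csc: "\<forall>j\<in>J. cs j \<in> constraints (n j) A B"
    and res: "restrictive_conj_minor A V J h (\<lambda>j. fst (cs j)) (fst c)"
    and ext: "extensive_conj_minor m B V J h (\<lambda>j. snd (cs j)) (snd c)"
    using minor unfolding conj_minor_def by auto
  have hset: "set (h j) \<subseteq> {..<m} <+> V" and hlen: "length (h j) = n j" if "j \<in> J" for j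
    using sch that unfolding minor_scheme_def nlists_def by auto
  obtain s where s: "\<And>a. a \<in> fst c \<Longrightarrow> s a \<in> V \<rightarrow> A"
    "\<And>a j. a \<in> fst c \<Longrightarrow> j \<in> J \<Longrightarrow> comp_tuple a (s a) (h j) \<in> fst (cs j)"
    using res unfolding restrictive_conj_minor_def by metis
  define q :: "'v \<Rightarrow> 'a minor_var" where "q = (\<lambda>v a. s a v)"
  define h' where "h' = (\<lambda>j. map (map_sum id q) (h j))"
  define J' where "J' = (\<lambda>j. (h' j, cs j)) ` J"
  have comp: "comp_tuple a \<tau> (h' j) = comp_tuple a (\<tau> \<circ> q) (h j)"
    for a :: "'c list" and \<tau> j
    unfolding comp_tuple_def h'_def by (auto split: sum.splits simp: map_sum_def)
  have h'set: "set (h' j) \<subseteq> {..<m} <+> q ` V" if "j \<in> J" for j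
    using hset[OF that] unfolding h'_def by (fastforce simp: map_sum_def)
  have "minor_scheme m (q ` V) J' (\<lambda>p. length (fst p)) fst"
    using sch hlen h'set unfolding minor_scheme_def J'_def nlists_def
    by (auto simp: h'_def)
  moreover have "\<forall>p\<in>J'. snd p \<in> constraints (length (fst p)) A B"
    using csc hlen by (auto simp: J'_def h'_def)
  moreover have "restrictive_conj_minor A (q ` V) J' fst (\<lambda>p. fst (snd p)) (fst c)"
    unfolding restrictive_conj_minor_def
  proof
    fix a assume a: "a \<in> fst c"
    have "(\<lambda>g. g a) \<in> q ` V \<rightarrow> A"
      using s(1)[OF a] by (auto simp: q_def)
    moreover have "(\<lambda>g. g a) \<circ> q = s a"
      by (auto simp: q_def)
    then have "\<forall>p\<in>J'. comp_tuple a (\<lambda>g. g a) (fst p) \<in> fst (snd p)"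
      using s(2)[OF a] by (auto simp: J'_def comp)
    ultimately show "\<exists>\<sigma>\<in>q ` V \<rightarrow> A. \<forall>p\<in>J'. comp_tuple a \<sigma> (fst p) \<in> fst (snd p)"
      by blast
  qed
  moreover have "extensive_conj_minor m B (q ` V) J' fst (\<lambda>p. snd (snd p)) (snd c)"
    unfolding extensive_conj_minor_def
  proof (intro ballI impI)
    fix b assume b: "b \<in> nlists m B"
      and "\<exists>\<tau>\<in>q ` V \<rightarrow> B. \<forall>p\<in>J'. comp_tuple b \<tau> (fst p) \<in> snd (snd p)"
    then obtain \<tau> where \<tau>: "\<tau> \<in> q ` V \<rightarrow> B"
      "\<forall>p\<in>J'. comp_tuple b \<tau> (fst p) \<in> snd (snd p)" by blast
    have "\<tau> \<circ> q \<in> V \<rightarrow> B" using \<tau>(1) by auto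
    moreover have "\<forall>j\<in>J. comp_tuple b (\<tau> \<circ> q) (h j) \<in> snd (cs j)"
      using \<tau>(2) by (auto simp: J'_def comp)
    ultimately show "b \<in> snd c"
      using ext b unfolding extensive_conj_minor_def by blast
  qed
  ultimately have "conj_minor A B m (q ` V) J' (\<lambda>p. length (fst p)) fst snd c"
    using c unfolding conj_minor_def by blast
  moreover have "\<forall>p\<in>J'. snd p \<in> T" using mem by (auto simp: J'_def)
  ultimately show "c \<in> T"
    using closed unfolding conj_minor_closed_def conj_minor_closed_over_def by blast
qed

end

theory Submission
  imports Defs
begin

text \<open>
  A function of arity \<open>n\<close> is an assignment of values in \<open>B\<close> to variables indexed by the rows
  \<open>A^n\<close>, and the functions satisfying all of \<open>T\<close> are the assignments solving one large
  conjunctive scheme, with one condition for every matrix with columns in the antecedent of a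
  member of \<open>T\<close>.  The coordinate projections solve this scheme on the side of \<open>A\<close>.  Hence, if a
  constraint has the columns of a matrix \<open>M\<close> as antecedent and every function satisfying
  \<open>T\<close> maps \<open>M\<close> into the consequent, then the constraint is a conjunctive minor of \<open>T\<close>; the
  equality constraint ties the coordinates of the minor to the rows of \<open>M\<close>.  Local closure
  reduces arbitrary antecedents to finite ones, and the empty constraint disposes of the empty
  antecedent, which is not the column set of any matrix.
\<close>

text \<open>As rewrite rules these two facts loop together with \<open>nlists_def\<close>.\<close>

declare nlistsE_length [simp del] nlistsE_set [simp del]

section \<open>Arities, rows and images of matrices\<close>

text \<open>Stands in for the missing arity tag: a tuple of the antecedent fixes the arity by its
  length, so ambiguity is confined to empty antecedents.\<close>

lemma constraints_arity_unique:
  assumes "c \<in> constraints m A B" "c \<in> constraints k A B" "a \<in> fst c"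
  shows "k = m"
proof -
  have "a \<in> nlists m A" "a \<in> nlists k A"
    using assms by (auto simp: constraints_def)
  then show ?thesis by (auto simp: nlists_def)
qed

lemma row_in_nlists:
  assumes "M \<in> nlists n (nlists m A)" "i < m"
  shows "map (\<lambda>a. a ! i) M \<in> nlists n A"
proof -
  have "a ! i \<in> A" if "a \<in> set M" for a
    using subsetD[OF nlistsE_set[OF assms(1)] that] assms(2) by (rule nlistsE_nth_in)
  then show ?thesis
    using assms(1) by (auto simp: nlists_def)
qed

lemma apply_matrix_in_nlists:
  assumes "f \<in> nlists n A \<rightarrow> B" "M \<in> nlists n (nlists m A)"
  shows "apply_matrix m f M \<in> nlists m B"
  using funcset_mem[OF assms(1) row_in_nlists[OF assms(2)]]
  by (auto simp: apply_matrix_def nlists_def)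

text \<open>The values \<open>s a v\<close> extend \<open>M\<close> by one row per variable
  \<open>v\<close>; \<open>h\<close> merely selects rows of the extended matrix, and selection
  commutes with applying \<open>f\<close> row by row.\<close>

lemma comp_tuple_apply_matrix:
  assumes "h \<in> nlists k ({..<m} <+> V)"
  shows "comp_tuple (apply_matrix m f M) (\<lambda>v. f (map (\<lambda>a. s a v) M)) h
    = apply_matrix k f (map (\<lambda>a. comp_tuple a (s a) h) M)"
proof (rule nth_equalityI)
  have len: "length h = k" and set: "set h \<subseteq> {..<m} <+> V"
    using assms by (auto simp: nlists_def)
  show "length (comp_tuple (apply_matrix m f M) (\<lambda>v. f (map (\<lambda>a. s a v) M)) h)
    = length (apply_matrix k f (map (\<lambda>a. comp_tuple a (s a) h) M))"
    using len by (simp add: comp_tuple_def apply_matrix_def)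
  fix i assume "i < length (comp_tuple (apply_matrix m f M) (\<lambda>v. f (map (\<lambda>a. s a v) M)) h)"
  then have i: "i < k" using len by (simp add: comp_tuple_def)
  then have "h ! i \<in> {..<m} <+> V" using len set nth_mem by blast
  then show "comp_tuple (apply_matrix m f M) (\<lambda>v. f (map (\<lambda>a. s a v) M)) h ! i
    = apply_matrix k f (map (\<lambda>a. comp_tuple a (s a) h) M) ! i"
    using i len by (auto simp: comp_tuple_def apply_matrix_def comp_def split: sum.splits)
qed

section \<open>Constraints satisfied by a set of functions\<close>

text \<open>Applying \<open>f\<close> to witnesses for the columns of a matrix yields a witness for
  its image.\<close>

lemma satisfies_conj_minor:
  assumes f: "(n, f) \<in> valued_functions A B"
    and minor: "conj_minor A B m V J k h cs c"
    and sat: "\<And>j. j \<in> J \<Longrightarrow> fst (cs j) \<noteq> {} \<Longrightarrow> satisfies (k j) (n, f) (cs j)"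
  shows "satisfies m (n, f) c"
proof -
  obtain R S where c_eq: "c = (R, S)" by (cases c)
  have fB: "f \<in> nlists n A \<rightarrow> B" and n: "n \<ge> 1"
    using f by (auto simp: valued_functions_def)
  have h: "\<And>j. j \<in> J \<Longrightarrow> h j \<in> nlists (k j) ({..<m} <+> V)"
    and c: "R \<subseteq> nlists m A"
    and res: "restrictive_conj_minor A V J h (\<lambda>j. fst (cs j)) R"
    and ext: "extensive_conj_minor m B V J h (\<lambda>j. snd (cs j)) S"
    using minor by (auto simp: c_eq conj_minor_def minor_scheme_def constraints_def)
  obtain s where s: "\<And>a. a \<in> R \<Longrightarrow> s a \<in> V \<rightarrow> A"
    "\<And>a j. a \<in> R \<Longrightarrow> j \<in> J \<Longrightarrow> comp_tuple a (s a) (h j) \<in> fst (cs j)"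
    using res unfolding restrictive_conj_minor_def by metis
  have "apply_matrix m f M \<in> S" if M: "M \<in> nlists n R" for M
  proof -
    have len: "length M = n" and cols: "set M \<subseteq> R"
      using M by (auto simp: nlists_def)
    define \<sigma> where "\<sigma> = (\<lambda>v. f (map (\<lambda>a. s a v) M))"
    have "map (\<lambda>a. s a v) M \<in> nlists n A" if "v \<in> V" for v
      using len cols funcset_mem[OF s(1) that] unfolding nlists_def by auto
    then have "\<sigma> \<in> V \<rightarrow> B"
      using fB by (auto simp: \<sigma>_def)
    moreover have "comp_tuple (apply_matrix m f M) \<sigma> (h j) \<in> snd (cs j)" if j: "j \<in> J" for j
    proof -
      \<comment> \<open>Since \<open>n \<ge> 1\<close> there is a column, and its witness gives the
        antecedent of \<open>cs j\<close> an element, as \<open>sat\<close> demands.\<close>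
      have "hd M \<in> R" using len n cols by (cases M) auto
      then have "fst (cs j) \<noteq> {}" using s(2) j by blast
      moreover have "map (\<lambda>a. comp_tuple a (s a) (h j)) M \<in> nlists n (fst (cs j))"
        using len cols s(2) j by (auto simp: nlists_def)
      ultimately show ?thesis
        using sat[OF j] comp_tuple_apply_matrix[OF h[OF j], of f M s]
        by (auto simp: satisfies_def \<sigma>_def split: prod.splits)
    qed
    moreover have "M \<in> nlists n (nlists m A)"
      using len cols c by (auto simp: nlists_def)
    then have "apply_matrix m f M \<in> nlists m B"
      by (rule apply_matrix_in_nlists[OF fB])
    ultimately show ?thesis
      using ext unfolding extensive_conj_minor_def by blast
  qed
  then show ?thesis by (simp add: c_eq satisfies_def)
qed

lemma eq_rel_constraint: "(eq_rel A, eq_rel B) \<in> constraints 2 A B"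
  by (auto simp: constraints_def eq_rel_def nlists_def)

lemma satisfies_eq_rel:
  assumes "(n, f) \<in> valued_functions A B"
  shows "satisfies 2 (n, f) (eq_rel A, eq_rel B)"
proof -
  have "apply_matrix 2 f M \<in> eq_rel B" if M: "M \<in> nlists n (eq_rel A)" for M
  proof -
    have cols: "\<exists>x\<in>A. a = [x, x]" if "a \<in> set M" for a
      using M that by (auto simp: nlists_def eq_rel_def)
    \<comment> \<open>Every column has the form \<open>[x, x]\<close>, so the two rows agree and
      \<open>f\<close> takes one value on both.\<close>
    have "map (\<lambda>a. a ! 1) M = map (\<lambda>a. a ! 0) M"
      using cols by fastforce
    moreover have "map (\<lambda>a. a ! 0) M \<in> nlists n A"
      using M cols by (fastforce simp: nlists_def)
    then have "f (map (\<lambda>a. a ! 0) M) \<in> B"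
      using assms by (auto simp: valued_functions_def)
    ultimately show ?thesis
      by (simp add: apply_matrix_def eq_rel_def numeral_2_eq_2 del: map_eq_conv)
  qed
  then show ?thesis by (simp add: satisfies_def)
qed

text \<open>The arity supplied by \<open>characterized_by\<close> can differ from \<open>m\<close>
  only when the antecedent is empty, and then satisfaction is automatic.\<close>

lemma characterized_by_iff:
  assumes T: "characterized_by A B T F" and F: "F \<subseteq> valued_functions A B"
    and c: "c \<in> constraints m A B" and m: "m \<ge> 1"
  shows "c \<in> T \<longleftrightarrow> (\<forall>\<phi>\<in>F. satisfies m \<phi> c)"
proof
  assume "c \<in> T"
  then obtain k where k: "c \<in> constraints k A B" "\<forall>\<phi>\<in>F. satisfies k \<phi> c"
    using T by (auto simp: characterized_by_def)
  show "\<forall>\<phi>\<in>F. satisfies m \<phi> c"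
  proof (cases "fst c = {}")
    case True
    \<comment> \<open>Functions have at least one argument, so no matrix has its columns in the
      empty set.\<close>
    then show ?thesis using F
      by (fastforce simp: satisfies_def valued_functions_def nlists_def)
  next
    case False
    then have "k = m" using constraints_arity_unique[OF c k(1)] by blast
    then show ?thesis using k(2) by simp
  qed
next
  assume "\<forall>\<phi>\<in>F. satisfies m \<phi> c"
  then show "c \<in> T" using T c m by (auto simp: characterized_by_def)
qed

text \<open>One application of a function involves only finitely many columns, so the relaxation
  with antecedent \<open>set M\<close> decides the outcome.\<close>

lemma characterized_by_imp_locally_closed:
  assumes T: "characterized_by A B T F" and F: "F \<subseteq> valued_functions A B"
  shows "locally_closed A B T"
  unfolding locally_closed_def
proof (intro allI ballI impI)
  fix m c
  assume m: "1 \<le> (m::nat)" and c: "c \<in> constraints m A B"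
    and rel: "\<forall>c'. relaxation m A B c' c \<and> finite (fst c') \<longrightarrow> c' \<in> T"
  obtain R S where c_eq: "c = (R, S)" by (cases c)
  have "apply_matrix m f M \<in> S" if \<phi>: "(n, f) \<in> F" and M: "M \<in> nlists n R" for n f M
  proof -
    have MR: "set M \<subseteq> R" and len: "length M = n" using M by (auto simp: nlists_def)
    then have c': "relaxation m A B (set M, S) c"
      using c by (auto simp: relaxation_def constraints_def c_eq)
    then have "(set M, S) \<in> T" using rel by auto
    then have "satisfies m (n, f) (set M, S)"
      using characterized_by_iff[OF T F _ m] c' \<phi> by (auto simp: relaxation_def)
    then show ?thesis using len by (auto simp: satisfies_def nlists_def)
  qed
  then show "c \<in> T"
    unfolding characterized_by_iff[OF T F c m] by (auto simp: satisfies_def c_eq)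
qed

lemma characterized_by_imp_conj_minor_closed:
  assumes T: "characterized_by A B T F" and F: "F \<subseteq> valued_functions A B"
  shows "conj_minor_closed_over TYPE('j) TYPE('v) A B T"
  unfolding conj_minor_closed_over_def
proof (intro allI impI, elim conjE)
  fix m and V :: "'v set" and J :: "'j set" and n h cs c
  assume mem: "\<forall>j\<in>J. cs j \<in> T" and minor: "conj_minor A B m V J n h cs c"
  have c: "c \<in> constraints m A B" and m: "m \<ge> 1"
    and cs: "\<And>j. j \<in> J \<Longrightarrow> cs j \<in> constraints (n j) A B \<and> n j \<ge> 1"
    using minor by (auto simp: conj_minor_def minor_scheme_def)
  have "satisfies m (k, f) c" if \<phi>: "(k, f) \<in> F" for k f
  proof (rule satisfies_conj_minor[OF _ minor])
    show "(k, f) \<in> valued_functions A B" using \<phi> F by blast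
    show "satisfies (n j) (k, f) (cs j)" if "j \<in> J" for j
      using characterized_by_iff[OF T F, of "cs j" "n j"] cs[OF that] mem that \<phi> by blast
  qed
  then show "c \<in> T"
    unfolding characterized_by_iff[OF T F c m] by auto
qed

section \<open>From the closure conditions to functions\<close>

text \<open>Lifts closure off the two fixed types, so that below the variables of a scheme can
  simply be rows in \<open>'a list\<close>.\<close>

lemma conj_minor_closedD:
  fixes V :: "'v set" and J :: "'j set"
  assumes "conj_minor_closed A B T" "conj_minor A B m V J n h cs c" "\<And>j. j \<in> J \<Longrightarrow> cs j \<in> T"
  shows "c \<in> T"
  using conj_minor_closed_all_types[OF assms(1), where 'j = 'j and 'v = 'v] assms(2,3)
  unfolding conj_minor_closed_over_def by blast

lemma empty_antecedent_mem:
  assumes closed: "conj_minor_closed A B T" and mem: "({}, {}) \<in> T"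
    and c: "({}, S) \<in> constraints m A B" and m: "m \<ge> 1"
  shows "({}, S) \<in> T"
proof -
  \<comment> \<open>No tuple over \<open>B\<close> meets a condition with empty consequent, so
    \<open>S\<close> is arbitrary. \<open>[Inl 0]\<close> names a position of the minor because
    \<open>m \<ge> 1\<close>.\<close>
  have "conj_minor A B m ({} :: unit set) {()} (\<lambda>_. 1) (\<lambda>_. [Inl 0]) (\<lambda>_. ({}, {})) ({}, S)"
    using c m by (auto simp: conj_minor_def minor_scheme_def restrictive_conj_minor_def
        extensive_conj_minor_def constraints_def nlists_def)
  then show ?thesis
    by (rule conj_minor_closedD[OF closed]) (rule mem)
qed

text \<open>One half of the Galois connection between functions and constraints. A member of
  \<open>T\<close> with several arities is tested at each of them.\<close>

definition polymorphisms ::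
    "'a set \<Rightarrow> 'b set \<Rightarrow> ('a, 'b) constraint set \<Rightarrow> (nat \<times> ('a list \<Rightarrow> 'b)) set" where
  "polymorphisms A B T =
    {\<phi> \<in> valued_functions A B. \<forall>k\<ge>1. \<forall>c \<in> T \<inter> constraints k A B. satisfies k \<phi> c}"

lemma finite_antecedent_mem:
  assumes closed: "conj_minor_closed A B T" and eq: "(eq_rel A, eq_rel B) \<in> T"
    and c: "(set M, S) \<in> constraints m A B" and m: "m \<ge> 1"
    and M: "length M = n" "n \<ge> 1"
    and sat: "\<And>f. (n, f) \<in> polymorphisms A B T \<Longrightarrow> apply_matrix m f M \<in> S"
  shows "(set M, S) \<in> T"
proof -
  define row where "row = (\<lambda>(N :: 'a list list) i. map (\<lambda>a. a ! i) N)"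
  \<comment> \<open>A variable is an argument tuple of an \<open>n\<close>-ary function, so an
    assignment from \<open>V\<close> to \<open>B\<close> is such a function.\<close>
  define V where "V = nlists n A"
  \<comment> \<open>Under an assignment \<open>f\<close>, such an index asks that \<open>f\<close>
    map the matrix \<open>N\<close> into the consequent of \<open>d\<close>.\<close>
  define J1 where "J1 = {(map (\<lambda>i. Inr (row N i) :: nat + 'a list) [0..<k], d) | k N d.
    k \<ge> 1 \<and> d \<in> T \<inter> constraints k A B \<and> N \<in> nlists n (fst d)}"
  \<comment> \<open>Equality ties coordinate \<open>i\<close> of the minor to the variable
    \<open>row M i\<close>.\<close>
  define J2 where "J2 = (\<lambda>i. ([Inl i, Inr (row M i)], (eq_rel A, eq_rel B))) ` {..<m}"
  have rowV: "row N i \<in> V" if "N \<in> nlists n (nlists k A)" "i < k" for N i k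
    unfolding row_def V_def using that by (rule row_in_nlists)
  have MA: "M \<in> nlists n (nlists m A)"
    using c M by (auto simp: constraints_def nlists_def[of n])
  have NA: "N \<in> nlists n (nlists k A)" if "d \<in> constraints k A B" "N \<in> nlists n (fst d)" for N k d
    using that nlists_mono by (fastforce simp: constraints_def)
  have "minor_scheme m V (J1 \<union> J2) (\<lambda>p. length (fst p)) fst"
  proof -
    have "J2 \<noteq> {}" using m by (auto simp: J2_def lessThan_empty_iff)
    moreover have "length (fst p) \<ge> 1 \<and> set (fst p) \<subseteq> {..<m} <+> V" if p_J1: "p \<in> J1" for p
    proof -
      obtain k N d where p: "p = (map (\<lambda>i. Inr (row N i)) [0..<k], d)" "k \<ge> 1"
        and N: "d \<in> constraints k A B" "N \<in> nlists n (fst d)"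
        using p_J1 unfolding J1_def by blast
      show ?thesis using rowV[OF NA[OF N]] p by auto
    qed
    moreover have "length (fst p) \<ge> 1 \<and> set (fst p) \<subseteq> {..<m} <+> V" if "p \<in> J2" for p
      using that rowV[OF MA] by (auto simp: J2_def)
    ultimately show ?thesis
      using m unfolding minor_scheme_def nlists_def by blast
  qed
  moreover have "\<forall>p\<in>J1 \<union> J2. snd p \<in> constraints (length (fst p)) A B"
    using eq_rel_constraint[of A B] by (auto simp: J1_def J2_def numeral_2_eq_2)
  moreover have "restrictive_conj_minor A V (J1 \<union> J2) fst (\<lambda>p. fst (snd p)) (set M)"
    unfolding restrictive_conj_minor_def
  proof
    fix a assume "a \<in> set M"
    then obtain p where p: "p < n" "a = M ! p" using M by (auto simp: in_set_conv_nth)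
    \<comment> \<open>The tuple \<open>a\<close> is column \<open>p\<close> of \<open>M\<close>; its
      witness is the projection to coordinate \<open>p\<close>.\<close>
    have \<sigma>: "(\<lambda>v. v ! p) \<in> V \<rightarrow> A" using p by (auto simp: V_def nlists_def)
    have aA: "a \<in> nlists m A"
      using MA \<open>a \<in> set M\<close> by (auto simp: nlists_def[of n])
    have "comp_tuple a (\<lambda>v. v ! p) h \<in> fst d" if hd: "(h, d) \<in> J1" for h d
    proof -
      obtain k N where h: "h = map (\<lambda>i. Inr (row N i)) [0..<k]"
        and d: "d \<in> constraints k A B" and N: "N \<in> nlists n (fst d)"
        using hd unfolding J1_def by blast
      \<comment> \<open>The projection sends the rows of \<open>N\<close> to the entries of its
        column \<open>p\<close>, which lies in the antecedent of \<open>d\<close>.\<close>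
      have Np: "N ! p \<in> fst d" using N p by (auto simp: nlists_def)
      then have "length (N ! p) = k" using d by (auto simp: constraints_def nlists_def)
      moreover have "row N i ! p = N ! p ! i" for i
        using N p by (simp add: row_def nlists_def)
      ultimately have "comp_tuple a (\<lambda>v. v ! p) h = N ! p"
        by (auto simp: comp_tuple_def h intro!: nth_equalityI)
      then show ?thesis using Np by simp
    qed
    moreover have "comp_tuple a (\<lambda>v. v ! p) h \<in> fst d" if hd: "(h, d) \<in> J2" for h d
      using hd p M nlistsE_nth_in[OF aA] by (auto simp: J2_def comp_tuple_def row_def eq_rel_def)
    ultimately show "\<exists>\<sigma>\<in>V \<rightarrow> A. \<forall>p\<in>J1 \<union> J2. comp_tuple a \<sigma> (fst p) \<in> fst (snd p)"
      using \<sigma> by (intro bexI[of _ "\<lambda>v. v ! p"]) auto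
  qed
  moreover have "extensive_conj_minor m B V (J1 \<union> J2) fst (\<lambda>p. snd (snd p)) S"
    unfolding extensive_conj_minor_def
  proof (intro ballI impI)
    fix b assume b: "b \<in> nlists m B"
      and "\<exists>\<sigma>\<in>V \<rightarrow> B. \<forall>p\<in>J1 \<union> J2. comp_tuple b \<sigma> (fst p) \<in> snd (snd p)"
    then obtain \<tau> where \<tau>: "\<tau> \<in> V \<rightarrow> B"
      and J: "\<And>p. p \<in> J1 \<union> J2 \<Longrightarrow> comp_tuple b \<tau> (fst p) \<in> snd (snd p)" by blast
    \<comment> \<open>Members of \<open>valued_functions\<close> are extensional, so the solution
      \<open>\<tau>\<close> is cut down to \<open>V\<close>.\<close>
    define f where "f = restrict \<tau> V"
    \<comment> \<open>The conditions in \<open>J1\<close> make \<open>f\<close> a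
      polymorphism.\<close>
    have "satisfies k (n, f) d" if d: "k \<ge> 1" "d \<in> T \<inter> constraints k A B" for k d
    proof -
      have "apply_matrix k f N \<in> snd d" if N: "N \<in> nlists n (fst d)" for N
      proof -
        have "(map (\<lambda>i. Inr (row N i)) [0..<k], d) \<in> J1"
          using d N unfolding J1_def by blast
        then have "map (\<lambda>i. \<tau> (row N i)) [0..<k] \<in> snd d"
          using J by (fastforce simp: comp_tuple_def comp_def)
        moreover have "apply_matrix k f N = map (\<lambda>i. \<tau> (row N i)) [0..<k]"
          using rowV[OF NA[OF _ N]] d by (auto simp: apply_matrix_def f_def row_def)
        ultimately show ?thesis by simp
      qed
      then show ?thesis by (cases d) (simp add: satisfies_def)
    qed
    moreover have "(n, f) \<in> valued_functions A B"
      using \<tau> M by (auto simp: valued_functions_def f_def V_def)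
    ultimately have "apply_matrix m f M \<in> S"
      by (intro sat) (auto simp: polymorphisms_def)
    \<comment> \<open>The conditions in \<open>J2\<close> force \<open>b\<close> to be the image of
      \<open>M\<close> under \<open>f\<close>.\<close>
    moreover have "b ! i = \<tau> (row M i)" if "i < m" for i
      using J[of "([Inl i, Inr (row M i)], (eq_rel A, eq_rel B))"] that
      by (auto simp: J2_def comp_tuple_def eq_rel_def)
    then have "b = apply_matrix m f M"
      using b rowV[OF MA]
      by (intro nth_equalityI) (auto simp: nlists_def apply_matrix_def f_def row_def)
    ultimately show "b \<in> S" by simp
  qed
  ultimately have "conj_minor A B m V (J1 \<union> J2) (\<lambda>p. length (fst p)) fst snd (set M, S)"
    using c by (simp add: conj_minor_def)
  then show ?thesis
    by (rule conj_minor_closedD[OF closed]) (use eq in \<open>auto simp: J1_def J2_def\<close>)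
qed

lemma characterized_by_polymorphisms:
  assumes T: "T \<subseteq> all_constraints A B" and loc: "locally_closed A B T"
    and eq: "(eq_rel A, eq_rel B) \<in> T" and empty: "({}, {}) \<in> T"
    and closed: "conj_minor_closed A B T"
  shows "characterized_by A B T (polymorphisms A B T)"
  unfolding characterized_by_def
proof
  show "T \<subseteq> (\<Union>m\<in>{1..}. {c \<in> constraints m A B. \<forall>\<phi>\<in>polymorphisms A B T. satisfies m \<phi> c})"
    using T by (fastforce simp: all_constraints_def polymorphisms_def)
  show "(\<Union>m\<in>{1..}. {c \<in> constraints m A B. \<forall>\<phi>\<in>polymorphisms A B T. satisfies m \<phi> c}) \<subseteq> T"
  proof clarify
    fix m R S
    assume m: "1 \<le> (m::nat)" and c: "(R, S) \<in> constraints m A B"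
      and sat: "\<forall>\<phi>\<in>polymorphisms A B T. satisfies m \<phi> (R, S)"
    \<comment> \<open>Local closure leaves only relaxations with finite antecedent.\<close>
    have "(R', S') \<in> T" if rel: "relaxation m A B (R', S') (R, S)" and fin: "finite R'" for R' S'
    proof -
      have c': "(R', S') \<in> constraints m A B" and R': "R' \<subseteq> R" and S': "S \<subseteq> S'"
        using rel by (auto simp: relaxation_def)
      \<comment> \<open>An enumeration of \<open>R'\<close> serves as a matrix; its length is the
        arity of the functions applied to it.\<close>
      obtain M where M: "set M = R'" using finite_list[OF fin] by blast
      show ?thesis
      proof (cases "M = []")
        case True
        then show ?thesis using empty_antecedent_mem[OF closed empty] c' m M by auto
      next
        case False
        have "apply_matrix m f M \<in> S'" if "(length M, f) \<in> polymorphisms A B T" for f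
          using bspec[OF sat that] M R' S' by (auto simp: satisfies_def nlists_def)
        then have "(set M, S') \<in> T"
          using False c' M
          by (intro finite_antecedent_mem[OF closed eq _ m refl]) (auto simp: Suc_le_eq)
        then show ?thesis using M by simp
      qed
    qed
    then show "(R, S) \<in> T"
      using loc m c unfolding locally_closed_def by (metis prod.collapse)
  qed
qed

theorem theorem2:
  fixes A :: "'a set" and B :: "'b set" and T :: "('a, 'b) constraint set"
  assumes "A \<noteq> {}" and "B \<noteq> {}" and "T \<subseteq> all_constraints A B"
  shows "(locally_closed A B T \<and> (eq_rel A, eq_rel B) \<in> T \<and> ({}, {}) \<in> T \<and> conj_minor_closed A B T)
     \<longleftrightarrow> (\<exists>F. F \<subseteq> valued_functions A B \<and> characterized_by A B T F)"
proof
  assume "locally_closed A B T \<and> (eq_rel A, eq_rel B) \<in> T \<and> ({}, {}) \<in> T \<and> conj_minor_closed A B T"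
  then have "characterized_by A B T (polymorphisms A B T)"
    using characterized_by_polymorphisms assms(3) by blast
  then show "\<exists>F. F \<subseteq> valued_functions A B \<and> characterized_by A B T F"
    by (intro exI[of _ "polymorphisms A B T"]) (auto simp: polymorphisms_def)
next
  assume "\<exists>F. F \<subseteq> valued_functions A B \<and> characterized_by A B T F"
  then obtain F where F: "F \<subseteq> valued_functions A B" and T: "characterized_by A B T F" by blast
  have "(eq_rel A, eq_rel B) \<in> T"
    using characterized_by_iff[OF T F eq_rel_constraint] satisfies_eq_rel F by fastforce
  \<comment> \<open>The empty constraint has every arity; arity 1 is picked to apply the
    criterion.\<close>
  moreover have "({}, {}) \<in> constraints 1 A B" by (simp add: constraints_def)
  then have "({}, {}) \<in> T"
    using characterized_by_iff[OF T F, of "({}, {})" 1] F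
    by (fastforce simp: satisfies_def valued_functions_def nlists_def)
  ultimately show "locally_closed A B T \<and> (eq_rel A, eq_rel B) \<in> T \<and> ({}, {}) \<in> T \<and> conj_minor_closed A B T"
    using characterized_by_imp_locally_closed[OF T F] characterized_by_imp_conj_minor_closed[OF T F]
    by (simp add: conj_minor_closed_def)
qed

end
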